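(* Let $\beta\in\mathbb{R}$, $\mathbf{V}\in\mathbb{R}_+^{F\times N}$, $K\in\mathbb{N}$, $\alpha>0$ and $\epsilon>0$, and let $\{(\mathbf{W}_i,\mathbf{H}_i)\}_{i\in\mathbb{N}}$ be the sequence of iterates produced by the algorithm MM-SNMF-log (defined in the context). Then the sequence of objective values $\big(\check{\mathcal{J}}_{\log}(\mathbf{W}_i,\mathbf{H}_i)\big)_{i\in\mathbb{N}}$, where $$\check{\mathcal{J}}_{\log}(\mathbf{W},\mathbf{H})=D_\beta(\mathbf{V}\mid\mathbf{W}\mathbf{H})+\alpha\sum_{k=1}^K\sum_{n=1}^N\log\big(\|\mathbf{w}_k\|_1h_{kn}+\epsilon\big),$$ is non-increasing and convergent.
   Context: $\mathbf{W}$ is $F\times K$ and $\mathbf{H}$ is $K\times N$, both entrywise nonnegative; $\mathbf{w}_k$ denotes the $k$-th column of $\mathbf{W}$, $\|\cdot\|_1$ the $\ell_1$ norm, $\mathbf{1}_{F\times N}$ the all-ones $F\times N$ matrix; $\odot$, fraction bars and $^{.a}$ between/on matrices denote entrywise product, division and power (a scalar in a numerator or sum is applied to every entry). $\beta$-divergence: $D_\beta(\mathbf{V}\mid\mathbf{W}\mathbf{H})=\sum_{f=1}^F\sum_{n=1}^N d_\beta(v_{fn}\mid[\mathbf{W}\mathbf{H}]_{fn})$, where $d_1(x\mid y)=x\log\frac{x}{y}-x+y$, $d_0(x\mid y)=\frac{x}{y}-\log\frac{x}{y}-1$, and $d_\beta(x\mid y)=\frac{x^\beta}{\beta(\beta-1)}+\frac{y^\beta}{\beta}-\frac{xy^{\beta-1}}{\beta-1}$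 for $\beta\notin\{0,1\}$. Exponent: $\gamma(\beta)=\frac{1}{2-\beta}$ if $\beta<1$, $\gamma(\beta)=1$ if $\beta\in[1,2]$, $\gamma(\beta)=\frac{1}{\beta-1}$ if $\beta>2$. Algorithm MM-SNMF-log: the input is the nonnegative matrix $\mathbf{V}$, an initialization $(\mathbf{W}_0,\mathbf{H}_0)=(\mathbf{W}_{\text{init}},\mathbf{H}_{\text{init}})$ and $\alpha>0$. For $i=0,1,2,\ldots$, given $(\mathbf{W}_i,\mathbf{H}_i)$, set $\boldsymbol{\Upsilon}=\mathbf{W}_i^\top\mathbf{1}_{F\times N}$, $\tilde{\mathbf{V}}=\mathbf{W}_i\mathbf{H}_i$ and $$\mathbf{H}_{i+1}=\mathbf{H}_i\odot\left(\frac{\mathbf{W}_i^\top(\mathbf{V}\odot\tilde{\mathbf{V}}^{.(\beta-2)})}{\mathbf{W}_i^\top\tilde{\mathbf{V}}^{.(\beta-1)}+\frac{\alpha}{\mathbf{H}_i+\frac{\epsilon}{\boldsymbol{\Upsilon}}}}\right)^{.\gamma(\beta)};$$ then set $\tilde{\mathbf{V}}=\mathbf{W}_i\mathbf{H}_{i+1}$ and $$\mathbf{W}_{i+1}=\mathbf{W}_i\odot\left(\frac{(\mathbf{V}\odot\tilde{\mathbf{V}}^{.(\beta-2)})\mathbf{H}_{i+1}^\top}{\tilde{\mathbf{V}}^{.(\beta-1)}\mathbf{H}_{i+1}^\top+\mathbf{1}_{F\times N}\left(\frac{\alpha}{\boldsymbol{\Upsilon}+\frac{\epsilon}{\mathbf{H}_{i+1}}}\right)^\top}\right)^{.\gamma(\beta)}.$$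 (In practice the loop is ended by a stopping criterion and the final pair is rescaled to $(\mathbf{W}_i\boldsymbol{\Lambda}^{-1},\boldsymbol{\Lambda}\mathbf{H}_i)$ with $\boldsymbol{\Lambda}$ the diagonal matrix of the $\ell_1$ norms of the columns of $\mathbf{W}_i$; the sequence considered is that of the loop iterates.)
   Formalization: Assumes that every term d_β(v_fn | [W_0H_0]_fn) of the initial divergence is finite: for β ≤ 1, [W_0H_0]_fn > 0 wherever v_fn > 0, and for β ≤ 0, all v_fn > 0; otherwise the objective is infinite at every iterate. *)

theory Defs
  imports "HOL-Analysis.Analysis"
begin

definition beta_div :: "real \<Rightarrow> real \<Rightarrow> real \<Rightarrow> real" where
  "beta_div \<beta> x y =
     (if \<beta> = 1 then x * ln (x / y) - x + y
      else if \<beta> = 0 then x / y - ln (x / y) - 1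
      else x powr \<beta> / (\<beta> * (\<beta> - 1)) + y powr \<beta> / \<beta> - x * y powr (\<beta> - 1) / (\<beta> - 1))"

text \<open>
  The pairs of nonnegative numbers at which the beta-divergence is finite: \<open>d(x|0)\<close> is infinite for
  \<open>x > 0\<close> and \<open>\<beta> \<le> 1\<close>, and \<open>d(0|y)\<close> is infinite for \<open>\<beta> \<le> 0\<close>. On this set the total functions
  \<open>ln\<close>, \<open>powr\<close> and division give \<open>beta_div\<close> its usual value, including the conventions
  \<open>0 log 0 = 0\<close> and \<open>d(0|0) = 0\<close> (for \<open>\<beta> > 0\<close>) at the boundary.
\<close>

definition beta_div_finite :: "real \<Rightarrow> real \<Rightarrow> real \<Rightarrow> bool" where
  "beta_div_finite \<beta> x y \<longleftrightarrow>
     0 \<le> x \<and> 0 \<le> y \<and> (\<beta> \<le> 1 \<longrightarrow> x = 0 \<or> 0 < y) \<and> (\<beta> \<le> 0 \<longrightarrow> 0 < x)"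

definition beta_div_mat :: "real \<Rightarrow> real^'n^'f \<Rightarrow> real^'n^'f \<Rightarrow> real" where
  "beta_div_mat \<beta> V Y = (\<Sum>f\<in>UNIV. \<Sum>n\<in>UNIV. beta_div \<beta> (V $ f $ n) (Y $ f $ n))"

definition gamma_exp :: "real \<Rightarrow> real" where
  "gamma_exp \<beta> = (if \<beta> < 1 then 1 / (2 - \<beta>) else if \<beta> \<le> 2 then 1 else 1 / (\<beta> - 1))"

definition mat_nonneg :: "real^'n^'m \<Rightarrow> bool" where
  "mat_nonneg A \<longleftrightarrow> (\<forall>i j. 0 \<le> A $ i $ j)"

definition ones :: "real^'n^'m" where
  "ones = (\<chi> i j. 1)"

definition col_l1 :: "real^'k^'f \<Rightarrow> 'k \<Rightarrow> real" where
  "col_l1 W k = (\<Sum>f\<in>UNIV. \<bar>W $ f $ k\<bar>)"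

text \<open>
  \<open>\<alpha> / (a + \<epsilon> / b)\<close> for \<open>a, b \<ge> 0\<close>, where \<open>\<epsilon> / 0\<close> stands for infinity, so that the value at
  \<open>b = 0\<close> is 0. (With HOL's \<open>\<epsilon> / 0 = 0\<close> the plain expression would be \<open>\<alpha> / a\<close> there.)
\<close>

definition log_weight :: "real \<Rightarrow> real \<Rightarrow> real \<Rightarrow> real \<Rightarrow> real" where
  "log_weight \<alpha> \<epsilon> a b = (if b = 0 then 0 else \<alpha> / (a + \<epsilon> / b))"

text \<open>
  Zero entries of the iterates remain zero in both updates. HOL's values of \<open>0 powr a\<close> are therefore
  immaterial below: an entry \<open>(W H)$f$n = 0\<close> of nonnegative \<open>W\<close>, \<open>H\<close> is combined either with a
  factor \<open>W$f$k = 0\<close> or with an entry \<open>H$k$n = 0\<close>, and dually. A quotient \<open>0 / 0\<close> is \<open>0\<close>; for an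
  entry that is not already zero it can occur only if the k-th column of \<open>W\<close> (in the update of
  \<open>H\<close>) or the k-th row of \<open>H\<close> (in the update of \<open>W\<close>) vanishes.
\<close>

definition update_H ::
  "real \<Rightarrow> real \<Rightarrow> real \<Rightarrow> real^'n^'f \<Rightarrow> real^'k^'f \<Rightarrow> real^'n^'k \<Rightarrow> real^'n^'k" where
  "update_H \<beta> \<alpha> \<epsilon> V W H =
     (let \<Upsilon> = transpose W ** (ones :: real^'n^'f);
          Y = W ** H;
          P = transpose W ** (\<chi> f n. V $ f $ n * (Y $ f $ n) powr (\<beta> - 2));
          Q = transpose W ** (\<chi> f n. (Y $ f $ n) powr (\<beta> - 1))
      in \<chi> k n. H $ k $ n *
           (P $ k $ n / (Q $ k $ n + log_weight \<alpha> \<epsilon> (H $ k $ n) (\<Upsilon> $ k $ n))) powr gamma_exp \<beta>)"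

text \<open>In \<open>update_W\<close> the argument \<open>H\<close> is the already updated activation matrix.\<close>

definition update_W ::
  "real \<Rightarrow> real \<Rightarrow> real \<Rightarrow> real^'n^'f \<Rightarrow> real^'k^'f \<Rightarrow> real^'n^'k \<Rightarrow> real^'k^'f" where
  "update_W \<beta> \<alpha> \<epsilon> V W H =
     (let \<Upsilon> = transpose W ** (ones :: real^'n^'f);
          Y = W ** H;
          P = (\<chi> f n. V $ f $ n * (Y $ f $ n) powr (\<beta> - 2)) ** transpose H;
          Q = (\<chi> f n. (Y $ f $ n) powr (\<beta> - 1)) ** transpose H;
          R = (ones :: real^'n^'f) ** transpose (\<chi> k n. log_weight \<alpha> \<epsilon> (\<Upsilon> $ k $ n) (H $ k $ n))
      in \<chi> f k. W $ f $ k * (P $ f $ k / (Q $ f $ k + R $ f $ k)) powr gamma_exp \<beta>)"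

primrec mm_snmf_log ::
  "real \<Rightarrow> real \<Rightarrow> real \<Rightarrow> real^'n^'f \<Rightarrow> real^'k^'f \<Rightarrow> real^'n^'k \<Rightarrow> nat \<Rightarrow> (real^'k^'f) \<times> (real^'n^'k)"
where
  "mm_snmf_log \<beta> \<alpha> \<epsilon> V W_init H_init 0 = (W_init, H_init)"
| "mm_snmf_log \<beta> \<alpha> \<epsilon> V W_init H_init (Suc i) =
     (let (W, H) = mm_snmf_log \<beta> \<alpha> \<epsilon> V W_init H_init i;
          H' = update_H \<beta> \<alpha> \<epsilon> V W H
      in (update_W \<beta> \<alpha> \<epsilon> V W H', H'))"

definition J_log ::
  "real \<Rightarrow> real \<Rightarrow> real \<Rightarrow> real^'n^'f \<Rightarrow> real^'k^'f \<Rightarrow> real^'n^'k \<Rightarrow> real" where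
  "J_log \<beta> \<alpha> \<epsilon> V W H =
     beta_div_mat \<beta> V (W ** H) + \<alpha> * (\<Sum>k\<in>UNIV. \<Sum>n\<in>UNIV. ln (col_l1 W k * H $ k $ n + \<epsilon>))"

end

(*
  Both updates are instances of one majorization step. Let h_a(r) = (r^a - 1)/a (and h_0 = ln), which
  is nondecreasing in a, convex for a >= 1 and concave for a <= 1. Then
    d(v | y r) - d(v | y) = y^\<beta> h_\<beta>(r) - v y^(\<beta>-1) h_(\<beta>-1)(r),
  and replacing \<beta> by b = max \<beta> 1 in the first term and \<beta> - 1 by c = min (\<beta> - 1) 1 in the second
  gives an upper bound to which Jensen's inequality applies. The logarithmic penalty is bounded by
  its tangent, whose slope l is absorbed through r - 1 = h_1(r) <= h_b(r). In the multiplier r of one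
  coordinate the surrogate is (Q + l) h_b(r) - P h_c(r), minimal where r^(b-c) = P / (Q + l); this is
  the update, because \<gamma>(\<beta>) = 1/(b - c).
*)
theory Submission
  imports Defs
begin

section \<open>Box-Cox functions: monotonicity in the exponent and Jensen inequalities\<close>

text \<open>The function h_a of the overview, known as the Box-Cox transform. At
  \<open>r = 0\<close> the value is -1/a for nonzero a, and 0 for a = 0 because
  \<open>ln 0 = 0\<close>. Only for \<open>0 < a\<close> is this the limit at 0, whence the side
  conditions at 0 below.\<close>

definition box_cox :: "real \<Rightarrow> real \<Rightarrow> real" where
  "box_cox a r = (if a = 0 then ln r else (r powr a - 1) / a)"

lemma box_cox_1 [simp]: "box_cox a 1 = 0"
  by (simp add: box_cox_def)

lemma box_cox_one_left: "0 \<le> r \<Longrightarrow> box_cox 1 r = r - 1"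
  by (simp add: box_cox_def)

lemma box_cox_zero: "a \<noteq> 0 \<Longrightarrow> box_cox a 0 = - 1 / a"
  by (simp add: box_cox_def)

lemma box_cox_has_derivative:
  assumes "0 < r"
  shows "(box_cox a has_real_derivative r powr (a - 1)) (at r)"
proof (cases "a = 0")
  case True
  then have "box_cox a = ln"
    by (auto simp: box_cox_def)
  then show ?thesis
    using assms True by (auto intro!: derivative_eq_intros simp: powr_minus inverse_eq_divide)
next
  case False
  then have "box_cox a = (\<lambda>r. (r powr a - 1) / a)"
    by (auto simp: box_cox_def)
  then show ?thesis
    using assms False by (auto intro!: derivative_eq_intros)
qed

text \<open>The difference of the two sides vanishes at 1, and its derivative t^(b-1) - t^(a-1) is
  nonnegative above 1 and nonpositive below, so 1 is a minimum.\<close>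

lemma box_cox_mono_pos:
  assumes "0 < r" and "a \<le> b"
  shows "box_cox a r \<le> box_cox b r"
proof -
  let ?g = "\<lambda>r. box_cox b r - box_cox a r"
  have deriv: "(?g has_real_derivative t powr (b - 1) - t powr (a - 1)) (at t)" if "0 < t" for t
    using that by (intro DERIV_diff box_cox_has_derivative)
  have "?g 1 \<le> ?g r"
  proof (cases "1 \<le> r")
    case True
    show ?thesis
    proof (rule DERIV_nonneg_imp_nondecreasing[OF True])
      fix t :: real assume t: "1 \<le> t" "t \<le> r"
      then show "\<exists>y. (?g has_real_derivative y) (at t) \<and> 0 \<le> y"
        using deriv[of t] assms(2) by (intro exI[of _ "t powr (b - 1) - t powr (a - 1)"]) (auto intro: powr_mono)
    qed
  next
    case False
    then have "r \<le> 1" by simp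
    then show ?thesis
    proof (rule DERIV_nonpos_imp_nonincreasing)
      fix t :: real assume t: "r \<le> t" "t \<le> 1"
      then show "\<exists>y. (?g has_real_derivative y) (at t) \<and> y \<le> 0"
        using deriv[of t] assms by (intro exI[of _ "t powr (b - 1) - t powr (a - 1)"]) (auto intro: powr_mono')
    qed
  qed
  then show ?thesis by simp
qed

lemma box_cox_mono:
  assumes "0 \<le> r" and "a \<le> b" and "r = 0 \<Longrightarrow> 0 < a"
  shows "box_cox a r \<le> box_cox b r"
proof (cases "r = 0")
  case True
  then show ?thesis
    using assms by (simp add: box_cox_zero frac_le)
next
  case False
  then show ?thesis
    using assms by (intro box_cox_mono_pos) auto
qed

text \<open>Moves the base point: estimates around 1 become estimates around an arbitrary
  \<open>r\<close>. For nonzero a it is (rs)^a - 1 = (r^a - 1) + r^a (s^a - 1).\<close>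

lemma box_cox_mult:
  assumes "0 < r" and "0 \<le> s" and "s = 0 \<Longrightarrow> 0 < a"
  shows "box_cox a (r * s) = box_cox a r + r powr a * box_cox a s"
proof (cases "a = 0")
  case True
  then show ?thesis using assms by (auto simp: box_cox_def ln_mult)
next
  case False
  then show ?thesis using assms by (simp add: box_cox_def powr_mult field_simps)
qed

text \<open>Jensen's inequality by tangents at the weighted mean \<open>\<rho>\<close>. After moving
  the base point to \<open>\<rho>\<close>, the tangent bound is s - 1 = h_1(s) \<le> h_a(s), that
  is, monotonicity in the exponent; the linear terms cancel in the sum.\<close>

lemma box_cox_convex:
  assumes "finite K" and c: "\<And>k. k \<in> K \<Longrightarrow> 0 \<le> c k" and r: "\<And>k. k \<in> K \<Longrightarrow> 0 \<le> r k"
    and pos: "0 < sum c K" and a: "1 \<le> a"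
  shows "sum c K * box_cox a ((\<Sum>k\<in>K. c k * r k) / sum c K) \<le> (\<Sum>k\<in>K. c k * box_cox a (r k))"
proof -
  define \<rho> where "\<rho> = (\<Sum>k\<in>K. c k * r k) / sum c K"
  have cr: "0 \<le> c k * r k" if "k \<in> K" for k using c r that by simp
  then have "0 \<le> \<rho>"
    using pos by (simp add: \<rho>_def sum_nonneg)
  show ?thesis
  proof (cases "\<rho> = 0")
    \<comment> \<open>The base point cannot be moved to 0, but here every \<open>r k\<close> of
      nonzero weight is 0 and both sides agree.\<close>
    case True
    then have "(\<Sum>k\<in>K. c k * r k) = 0" using pos by (simp add: \<rho>_def)
    then have zero: "c k * r k = 0" if "k \<in> K" for k
      using cr assms(1) that sum_nonneg_eq_0_iff[of K "\<lambda>k. c k * r k"] by auto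
    have "c k * box_cox a (r k) = c k * box_cox a 0" if "k \<in> K" for k
      using zero[OF that] by auto
    then have "(\<Sum>k\<in>K. c k * box_cox a (r k)) = (\<Sum>k\<in>K. c k * box_cox a 0)"
      by (rule sum.cong[OF refl])
    then show ?thesis
      using True unfolding \<rho>_def[symmetric] by (simp add: sum_distrib_right)
  next
    case False
    with \<open>0 \<le> \<rho>\<close> have \<rho>: "0 < \<rho>" by simp
    have tangent: "c k * box_cox a \<rho> + \<rho> powr a * (c k * r k / \<rho> - c k) \<le> c k * box_cox a (r k)"
      if "k \<in> K" for k
    proof -
      have "box_cox a (r k) = box_cox a \<rho> + \<rho> powr a * box_cox a (r k / \<rho>)"
        using box_cox_mult[of \<rho> "r k / \<rho>" a] \<rho> r[OF that] a by simp
      moreover have "r k / \<rho> - 1 \<le> box_cox a (r k / \<rho>)"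
        using box_cox_mono[of "r k / \<rho>" 1 a] \<rho> r[OF that] a by (simp add: box_cox_one_left)
      ultimately have "box_cox a \<rho> + \<rho> powr a * (r k / \<rho> - 1) \<le> box_cox a (r k)"
        by (simp add: mult_left_mono)
      from mult_left_mono[OF this c[OF that]] show ?thesis by (simp add: algebra_simps)
    qed
    have "(\<Sum>k\<in>K. c k * box_cox a \<rho> + \<rho> powr a * (c k * r k / \<rho> - c k))
        = sum c K * box_cox a \<rho> + \<rho> powr a * ((\<Sum>k\<in>K. c k * r k) / \<rho> - sum c K)"
      by (simp add: sum.distrib sum_distrib_right sum_subtractf sum_divide_distrib flip: sum_distrib_left)
    also have "(\<Sum>k\<in>K. c k * r k) / \<rho> = sum c K"
      using \<rho> pos by (simp add: \<rho>_def field_simps)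
    finally have "sum c K * box_cox a \<rho> = (\<Sum>k\<in>K. c k * box_cox a \<rho> + \<rho> powr a * (c k * r k / \<rho> - c k))"
      by simp
    also have "\<dots> \<le> (\<Sum>k\<in>K. c k * box_cox a (r k))"
      by (intro sum_mono tangent)
    finally show ?thesis by (simp add: \<rho>_def)
  qed
qed

text \<open>The same tangent argument with h_a(s) \<le> h_1(s) = s - 1. The exponent may now be 0 or
  negative, so multipliers of positive weight have to be positive; terms of weight 0 are
  harmless.\<close>

lemma box_cox_concave:
  assumes "finite K" and c: "\<And>k. k \<in> K \<Longrightarrow> 0 \<le> c k" and r: "\<And>k. k \<in> K \<Longrightarrow> 0 < c k \<Longrightarrow> 0 < r k"
    and pos: "0 < sum c K" and a: "a \<le> 1"
  shows "(\<Sum>k\<in>K. c k * box_cox a (r k)) \<le> sum c K * box_cox a ((\<Sum>k\<in>K. c k * r k) / sum c K)"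
proof -
  define \<rho> where "\<rho> = (\<Sum>k\<in>K. c k * r k) / sum c K"
  obtain j where j: "j \<in> K" "0 < c j"
    using pos by (meson not_less sum_nonpos)
  have "0 \<le> c k * r k" if "k \<in> K" for k
    using c[OF that] r[OF that] by (cases "c k = 0") auto
  then have "0 < (\<Sum>k\<in>K. c k * r k)"
    using assms(1) j r[OF j] by (intro sum_pos2[of K j]) auto
  then have \<rho>: "0 < \<rho>"
    using pos by (simp add: \<rho>_def)
  have tangent: "c k * box_cox a (r k) \<le> c k * box_cox a \<rho> + \<rho> powr a * (c k * r k / \<rho> - c k)"
    if "k \<in> K" for k
  proof (cases "c k = 0")
    case False
    then have rk: "0 < r k" using c[OF that] r[OF that] by simp
    have "box_cox a (r k) = box_cox a \<rho> + \<rho> powr a * box_cox a (r k / \<rho>)"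
      using box_cox_mult[of \<rho> "r k / \<rho>" a] \<rho> rk by simp
    moreover have "box_cox a (r k / \<rho>) \<le> r k / \<rho> - 1"
      using box_cox_mono[of "r k / \<rho>" a 1] \<rho> rk a by (simp add: box_cox_one_left)
    ultimately have "box_cox a (r k) \<le> box_cox a \<rho> + \<rho> powr a * (r k / \<rho> - 1)"
      by (simp add: mult_left_mono)
    from mult_left_mono[OF this c[OF that]] show ?thesis by (simp add: algebra_simps)
  qed simp
  have "(\<Sum>k\<in>K. c k * box_cox a (r k))
      \<le> (\<Sum>k\<in>K. c k * box_cox a \<rho> + \<rho> powr a * (c k * r k / \<rho> - c k))"
    by (intro sum_mono tangent)
  also have "\<dots> = sum c K * box_cox a \<rho> + \<rho> powr a * ((\<Sum>k\<in>K. c k * r k) / \<rho> - sum c K)"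
    by (simp add: sum.distrib sum_distrib_right sum_subtractf sum_divide_distrib flip: sum_distrib_left)
  also have "(\<Sum>k\<in>K. c k * r k) / \<rho> = sum c K"
    using \<rho> pos by (simp add: \<rho>_def field_simps)
  finally show ?thesis by (simp add: \<rho>_def)
qed

text \<open>Monotonicity in the exponent, read at \<open>1 / r\<close>.\<close>

lemma box_cox_le_powr_mult:
  assumes "0 < r" and "a \<le> b"
  shows "box_cox b r \<le> r powr (b - a) * box_cox a r"
proof -
  \<comment> \<open>The product rule at r * (1/r) = 1, where \<open>box_cox\<close>
    vanishes.\<close>
  have inv: "box_cox a r = - (r powr a * box_cox a (1 / r))" for a
    using box_cox_mult[of r "1 / r" a] assms by simp
  have "r powr b * box_cox a (1 / r) \<le> r powr b * box_cox b (1 / r)"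
    using assms by (intro mult_left_mono box_cox_mono_pos) auto
  then show ?thesis
    using assms by (subst inv[of a], subst inv[of b]) (simp add: powr_diff)
qed

section \<open>The beta-divergence and its separable majorization\<close>

text \<open>Expresses the change under rescaling of the second argument by two Box-Cox terms. The
  factor \<open>\<rho>\<close> may be 0 only when \<open>v = 0\<close>; then \<beta> is positive,
  the second term drops out, and \<open>box_cox \<beta> 0\<close> is the correct limit.\<close>

lemma beta_div_scale:
  assumes "0 < y" and "0 \<le> v" and "0 \<le> \<rho>" and "v = 0 \<Longrightarrow> 0 < \<beta>" and "0 < v \<Longrightarrow> 0 < \<rho>"
  shows "beta_div \<beta> v (y * \<rho>) - beta_div \<beta> v y
    = y powr \<beta> * box_cox \<beta> \<rho> - v * y powr (\<beta> - 1) * box_cox (\<beta> - 1) \<rho>"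
proof (cases "v = 0")
  case True
  with assms have "0 < \<beta>" by simp
  then show ?thesis
    using assms True
    by (cases "\<beta> = 1") (auto simp: beta_div_def box_cox_def powr_mult field_simps)
next
  case False
  then have "0 < v" "0 < \<rho>" using assms by auto
  consider "\<beta> = 0" | "\<beta> = 1" | "\<beta> \<noteq> 0" "\<beta> \<noteq> 1" by blast
  then show ?thesis
  proof cases
    case 1
    then show ?thesis
      using \<open>0 < v\<close> \<open>0 < \<rho>\<close> \<open>0 < y\<close>
      by (simp add: beta_div_def box_cox_def powr_minus ln_mult ln_div field_simps)
  next
    case 2
    then show ?thesis
      using \<open>0 < v\<close> \<open>0 < \<rho>\<close> \<open>0 < y\<close>
      by (simp add: beta_div_def box_cox_def ln_mult ln_div algebra_simps)
  next
    case 3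
    then show ?thesis
      using \<open>0 < v\<close> \<open>0 < \<rho>\<close> \<open>0 < y\<close>
      by (simp add: beta_div_def box_cox_def powr_mult diff_divide_distrib right_diff_distrib mult.assoc)
  qed
qed

lemma beta_div_refl: "0 < x \<Longrightarrow> beta_div \<beta> x x = 0"
  by (simp add: beta_div_def powr_diff field_simps)

text \<open>For positive arguments, scaling from the point \<open>x\<close> gives x^\<beta> times
  h_\<beta> - h_(\<beta>-1) at y/x, which is nonnegative by monotonicity in the exponent.\<close>

lemma beta_div_nonneg:
  assumes "beta_div_finite \<beta> x y"
  shows "0 \<le> beta_div \<beta> x y"
proof -
  have nn: "0 \<le> x" "0 \<le> y" using assms by (auto simp: beta_div_finite_def)
  consider "x = 0" | "0 < x" "y = 0" | "0 < x" "0 < y" using nn by linarith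
  then show ?thesis
  proof cases
    case 1
    then show ?thesis using assms nn by (auto simp: beta_div_finite_def beta_div_def)
  next
    case 2
    then show ?thesis using assms nn by (auto simp: beta_div_finite_def beta_div_def)
  next
    case 3
    have "beta_div \<beta> x y = x powr \<beta> * (box_cox \<beta> (y / x) - box_cox (\<beta> - 1) (y / x))"
      using beta_div_scale[of x x "y / x" \<beta>] 3
      by (simp add: beta_div_refl powr_diff field_simps)
    then show ?thesis
      using box_cox_mono_pos[of "y / x" "\<beta> - 1" \<beta>] 3 by simp
  qed
qed

text \<open>The surrogate for one matrix entry: \<open>c k\<close> are the current summands of that
  entry of the product and \<open>r k\<close> their multipliers. The bound is a sum over k of
  functions of a single \<open>r k\<close>, and it is 0 when all multipliers are 1.\<close>

lemma beta_div_majorize: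
  fixes c r :: "'k \<Rightarrow> real"
  assumes K: "finite K" and c: "\<And>k. k \<in> K \<Longrightarrow> 0 \<le> c k" and r: "\<And>k. k \<in> K \<Longrightarrow> 0 \<le> r k"
    and fin: "beta_div_finite \<beta> v (sum c K)"
    and pos: "\<And>k. k \<in> K \<Longrightarrow> 0 < v \<Longrightarrow> 0 < c k \<Longrightarrow> 0 < r k"
  shows "beta_div \<beta> v (\<Sum>k\<in>K. c k * r k) - beta_div \<beta> v (sum c K)
    \<le> (\<Sum>k\<in>K. c k * (sum c K powr (\<beta> - 1) * box_cox (max \<beta> 1) (r k)
                      - v * sum c K powr (\<beta> - 2) * box_cox (min (\<beta> - 1) 1) (r k)))"
proof (cases "sum c K = 0")
  case True
  then have "c k = 0" if "k \<in> K" for k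
    using K c that sum_nonneg_eq_0_iff[of K c] by auto
  then show ?thesis by simp
next
  case False
  define y where "y = sum c K"
  have y: "0 < y" using False c by (simp add: y_def less_le sum_nonneg)
  have v: "0 \<le> v" "v = 0 \<Longrightarrow> 0 < \<beta>" using fin by (auto simp: beta_div_finite_def)
  define \<rho> where "\<rho> = (\<Sum>k\<in>K. c k * r k) / y"
  have \<rho>0: "0 \<le> \<rho>" using c r y by (simp add: \<rho>_def sum_nonneg)
  obtain j where j: "j \<in> K" "0 < c j"
    using y unfolding y_def by (meson not_less sum_nonpos)
  have \<rho>: "0 < \<rho>" if "0 < v"
  proof -
    have "0 < (\<Sum>k\<in>K. c k * r k)"
      using K j pos[OF j(1) that j(2)] c r by (intro sum_pos2[of K j]) auto
    then show ?thesis using y by (simp add: \<rho>_def)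
  qed
  let ?b = "box_cox (max \<beta> 1)" and ?c = "box_cox (min (\<beta> - 1) 1)"
  have up: "y * box_cox \<beta> \<rho> \<le> (\<Sum>k\<in>K. c k * ?b (r k))"
  proof -
    \<comment> \<open>If \<open>\<rho> = 0\<close> then \<open>v = 0\<close>, so \<beta> is positive
      and the comparison of exponents is valid at 0 too.\<close>
    have "box_cox \<beta> \<rho> \<le> ?b \<rho>"
      using \<rho>0 \<rho> v by (intro box_cox_mono) (auto simp: less_le)
    then have "y * box_cox \<beta> \<rho> \<le> y * ?b \<rho>" using y by simp
    also have "\<dots> \<le> (\<Sum>k\<in>K. c k * ?b (r k))"
      using box_cox_convex[OF K c r, where a="max \<beta> 1"] y by (simp add: y_def \<rho>_def)
    finally show ?thesis .
  qed
  \<comment> \<open>The factor \<open>v\<close> is kept, since only for positive \<open>v\<close>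
    are the multipliers known to be positive, as concavity requires.\<close>
  have lo: "v * (\<Sum>k\<in>K. c k * ?c (r k)) \<le> v * (y * box_cox (\<beta> - 1) \<rho>)"
  proof (cases "v = 0")
    case False
    then have v': "0 < v" using v by simp
    have "(\<Sum>k\<in>K. c k * ?c (r k)) \<le> y * ?c \<rho>"
      using box_cox_concave[OF K c pos[OF _ v'], where a="min (\<beta> - 1) 1"] y by (simp add: y_def \<rho>_def)
    also have "\<dots> \<le> y * box_cox (\<beta> - 1) \<rho>"
      using y \<rho>[OF v'] by (intro mult_left_mono box_cox_mono_pos) auto
    finally show ?thesis using v' by simp
  qed simp
  have "beta_div \<beta> v (\<Sum>k\<in>K. c k * r k) - beta_div \<beta> v y
      = y powr \<beta> * box_cox \<beta> \<rho> - v * y powr (\<beta> - 1) * box_cox (\<beta> - 1) \<rho>"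
    using beta_div_scale[of y v \<rho> \<beta>] y v \<rho>0 \<rho> by (simp add: \<rho>_def)
  also have "\<dots> = y powr (\<beta> - 1) * (y * box_cox \<beta> \<rho>) - y powr (\<beta> - 2) * (v * (y * box_cox (\<beta> - 1) \<rho>))"
    using y by (simp add: powr_diff power2_eq_square)
  also have "\<dots> \<le> y powr (\<beta> - 1) * (\<Sum>k\<in>K. c k * ?b (r k)) - y powr (\<beta> - 2) * (v * (\<Sum>k\<in>K. c k * ?c (r k)))"
    by (intro diff_mono mult_left_mono[OF up] mult_left_mono[OF lo]) auto
  also have "\<dots> = (\<Sum>k\<in>K. c k * (y powr (\<beta> - 1) * ?b (r k) - v * y powr (\<beta> - 2) * ?c (r k)))"
    by (simp add: sum_distrib_left sum_subtractf[symmetric] algebra_simps)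
  finally show ?thesis by (simp add: y_def)
qed

section \<open>The multiplicative update decreases the linearized objective\<close>

lemma gamma_exp_eq: "gamma_exp \<beta> = 1 / (max \<beta> 1 - min (\<beta> - 1) 1)"
  by (simp add: gamma_exp_def)

text \<open>Descent needs only that the surrogate q h_b - p h_c at the update is at most its value 0
  at multiplier 1. Since r^(b-c) = p/q, this is \<open>box_cox_le_powr_mult\<close> times
  \<open>q\<close>.\<close>

lemma surrogate_at_minimum:
  fixes \<beta> p q :: real
  assumes "0 \<le> p" and "0 \<le> q" and "q = 0 \<Longrightarrow> p = 0"
  defines "r \<equiv> (p / q) powr gamma_exp \<beta>"
  shows "q * box_cox (max \<beta> 1) r \<le> p * box_cox (min (\<beta> - 1) 1) r"
proof (cases "p = 0")
  case True
  then have "r = 0" by (simp add: r_def)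
  then show ?thesis
    using True \<open>0 \<le> q\<close> by (simp add: box_cox_zero divide_nonpos_pos)
next
  case False
  then have pq: "0 < p" "0 < q" using assms(1-3) by (auto simp: less_le)
  then have r: "0 < r" by (simp add: r_def)
  have "r powr (max \<beta> 1 - min (\<beta> - 1) 1) = p / q"
    using pq by (simp add: r_def gamma_exp_eq powr_powr max_def min_def)
  then have p: "p = q * r powr (max \<beta> 1 - min (\<beta> - 1) 1)"
    using pq by simp
  have "box_cox (max \<beta> 1) r \<le> r powr (max \<beta> 1 - min (\<beta> - 1) 1) * box_cox (min (\<beta> - 1) 1) r"
    by (rule box_cox_le_powr_mult[OF r]) simp
  from mult_left_mono[OF this \<open>0 \<le> q\<close>] show ?thesis
    by (subst p) (simp only: mult.assoc)
qed

text \<open>One formula for both updates: \<open>A\<close> is the fixed factor, \<open>x\<close> a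
  column of H or a row of W, \<open>v\<close> the matching column or row of data, and
  \<open>l\<close> the slopes of the linearized penalty.\<close>

definition mm_ratio ::
  "real \<Rightarrow> ('j::finite \<Rightarrow> 'k::finite \<Rightarrow> real) \<Rightarrow> ('j \<Rightarrow> real) \<Rightarrow> ('k \<Rightarrow> real) \<Rightarrow> ('k \<Rightarrow> real) \<Rightarrow> 'k \<Rightarrow> real"
where
  "mm_ratio \<beta> A v l x k =
     ((\<Sum>j\<in>UNIV. A j k * (v j * (\<Sum>i\<in>UNIV. A j i * x i) powr (\<beta> - 2)))
      / ((\<Sum>j\<in>UNIV. A j k * (\<Sum>i\<in>UNIV. A j i * x i) powr (\<beta> - 1)) + l k)) powr gamma_exp \<beta>"

lemma mm_ratio_nonneg: "0 \<le> mm_ratio \<beta> A v l x k"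
  by (simp add: mm_ratio_def)

text \<open>Descent for a single column of H or row of W, with the penalty replaced by a linear
  function of slopes \<open>l\<close>. The finiteness claim lets the step be iterated.\<close>

lemma mm_step:
  fixes \<beta> :: real and A :: "'j::finite \<Rightarrow> 'k::finite \<Rightarrow> real"
  assumes A: "\<And>j k. 0 \<le> A j k" and x: "\<And>k. 0 \<le> x k" and l: "\<And>k. 0 \<le> l k"
    and fin: "\<And>j. beta_div_finite \<beta> (v j) (\<Sum>k\<in>UNIV. A j k * x k)"
  defines "x' \<equiv> \<lambda>k. x k * mm_ratio \<beta> A v l x k"
  shows mm_step_finite: "beta_div_finite \<beta> (v j) (\<Sum>k\<in>UNIV. A j k * x' k)"
    and mm_step_decreasing: "(\<Sum>j\<in>UNIV. beta_div \<beta> (v j) (\<Sum>k\<in>UNIV. A j k * x' k))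
      + (\<Sum>k\<in>UNIV. l k * (x' k - x k))
      \<le> (\<Sum>j\<in>UNIV. beta_div \<beta> (v j) (\<Sum>k\<in>UNIV. A j k * x k))"
proof -
  define y where "y = (\<lambda>j. \<Sum>k\<in>UNIV. A j k * x k)"
  define P where "P = (\<lambda>k. \<Sum>j\<in>UNIV. A j k * (v j * y j powr (\<beta> - 2)))"
  define Q where "Q = (\<lambda>k. \<Sum>j\<in>UNIV. A j k * y j powr (\<beta> - 1))"
  define r where "r = mm_ratio \<beta> A v l x"
  have r_eq: "r k = (P k / (Q k + l k)) powr gamma_exp \<beta>" for k
    by (simp add: r_def mm_ratio_def P_def Q_def y_def)
  have r0: "0 \<le> r k" for k by (simp add: r_eq)
  have v: "0 \<le> v j" for j using fin[of j] by (simp add: beta_div_finite_def)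
  have Ax: "0 \<le> A j k * x k" for j k using A x by simp
  have Ax': "A j k * x' k = A j k * x k * r k" for j k by (simp add: x'_def r_def)
  have P0: "0 \<le> P k" for k using A v by (simp add: P_def sum_nonneg)
  have Q0: "0 \<le> Q k" for k using A by (simp add: Q_def sum_nonneg)
  have y_pos: "0 < y j" if "0 < A j k * x k" for j k
    unfolding y_def using that Ax by (intro sum_pos2[of UNIV k]) auto
  have Q_pos: "0 < Q k" if "0 < A j k * x k" for j k
  proof -
    have "0 < A j k" using that A[of j k] by (cases "A j k = 0") auto
    then have "0 < A j k * y j powr (\<beta> - 1)" using y_pos[OF that] by simp
    then show ?thesis unfolding Q_def using A by (intro sum_pos2[of UNIV j]) auto
  qed
  \<comment> \<open>A summand that contributes to a positive data entry is not annihilated. This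
    yields the positivity that the majorization asks for and keeps the divergence finite.\<close>
  have r_pos: "0 < r k" if v_pos: "0 < v j" and Axp: "0 < A j k * x k" for j k
  proof -
    have "0 < A j k" using Axp A[of j k] by (cases "A j k = 0") auto
    then have "0 < A j k * (v j * y j powr (\<beta> - 2))" using v_pos y_pos[OF Axp] by simp
    then have "0 < P k" unfolding P_def using A v by (intro sum_pos2[of UNIV j]) auto
    then show ?thesis using Q_pos[OF Axp] l[of k] by (simp add: r_eq add_pos_nonneg)
  qed
  show "beta_div_finite \<beta> (v j) (\<Sum>k\<in>UNIV. A j k * x' k)"
  proof -
    have nn: "0 \<le> A j k * x' k" for k using Ax r0 by (simp add: Ax')
    have "0 < (\<Sum>k\<in>UNIV. A j k * x' k)" if v_pos: "0 < v j" and yj: "0 < y j"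
    proof -
      obtain k where k: "0 < A j k * x k"
        using yj unfolding y_def by (meson not_less sum_nonpos)
      then have "0 < A j k * x' k" using r_pos[OF v_pos k] by (simp add: Ax')
      then show ?thesis using nn by (intro sum_pos2[of UNIV k]) auto
    qed
    moreover have "0 \<le> (\<Sum>k\<in>UNIV. A j k * x' k)" using nn by (simp add: sum_nonneg)
    ultimately show ?thesis
      using fin[of j, folded y_def] v[of j]
      by (cases "v j = 0") (auto simp: beta_div_finite_def y_def less_le)
  qed
  let ?b = "box_cox (max \<beta> 1)" and ?c = "box_cox (min (\<beta> - 1) 1)"
  have "(\<Sum>j\<in>UNIV. beta_div \<beta> (v j) (\<Sum>k\<in>UNIV. A j k * x' k) - beta_div \<beta> (v j) (y j))
      \<le> (\<Sum>j\<in>UNIV. \<Sum>k\<in>UNIV. A j k * x k * (y j powr (\<beta> - 1) * ?b (r k) - v j * y j powr (\<beta> - 2) * ?c (r k)))"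
    unfolding Ax' y_def
    by (intro sum_mono beta_div_majorize) (use Ax r0 fin r_pos in auto)
  \<comment> \<open>Exchanging the sums decouples the coordinates and produces the numerator
    \<open>P\<close> and denominator \<open>Q\<close> of the update.\<close>
  also have "\<dots> = (\<Sum>k\<in>UNIV. x k * (Q k * ?b (r k) - P k * ?c (r k)))"
    unfolding P_def Q_def
    by (subst sum.swap, intro sum.cong)
       (simp_all add: sum_distrib_left sum_distrib_right sum_subtractf[symmetric] algebra_simps)
  also have "\<dots> \<le> (\<Sum>k\<in>UNIV. - (l k * (x' k - x k)))"
  proof (intro sum_mono)
    fix k
    \<comment> \<open>The linear penalty is absorbed into the convex term because the exponent
      \<open>max \<beta> 1\<close> is at least 1.\<close>
    have lin: "l k * (r k - 1) \<le> l k * ?b (r k)"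
      using box_cox_mono[of "r k" 1 "max \<beta> 1"] r0[of k] l[of k]
      by (intro mult_left_mono) (auto simp: box_cox_one_left)
    have "x k * (Q k * ?b (r k) - P k * ?c (r k)) \<le> x k * (- (l k * (r k - 1)))"
    proof (cases "x k = 0")
      case False
      \<comment> \<open>The quotient 0/0: for nonzero \<open>x k\<close>, a vanishing
        \<open>Q k\<close> forces column k of \<open>A\<close> to vanish.\<close>
      have "P k = 0" if "Q k + l k = 0"
      proof -
        have "Q k = 0" using that Q0[of k] l[of k] by simp
        then have "A j k = 0" for j
          using Q_pos[of j k] A[of j k] x[of k] False by (cases "A j k = 0") (auto simp: less_le)
        then show ?thesis by (simp add: P_def)
      qed
      then have "(Q k + l k) * ?b (r k) \<le> P k * ?c (r k)"
        unfolding r_eq using P0[of k] Q0[of k] l[of k] by (intro surrogate_at_minimum) auto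
      then have "Q k * ?b (r k) - P k * ?c (r k) \<le> - (l k * (r k - 1))"
        using lin by (simp add: algebra_simps)
      then show ?thesis using x[of k] by (rule mult_left_mono)
    qed simp
    then show "x k * (Q k * ?b (r k) - P k * ?c (r k)) \<le> - (l k * (x' k - x k))"
      by (simp add: x'_def r_def[symmetric] algebra_simps)
  qed
  finally show "(\<Sum>j\<in>UNIV. beta_div \<beta> (v j) (\<Sum>k\<in>UNIV. A j k * x' k))
      + (\<Sum>k\<in>UNIV. l k * (x' k - x k))
      \<le> (\<Sum>j\<in>UNIV. beta_div \<beta> (v j) (\<Sum>k\<in>UNIV. A j k * x k))"
    by (simp add: sum_subtractf sum_negf y_def)
qed

section \<open>Linearization of the logarithmic penalty\<close>

lemma log_weight_nonneg: "0 < \<alpha> \<Longrightarrow> 0 < \<epsilon> \<Longrightarrow> 0 \<le> a \<Longrightarrow> 0 \<le> b \<Longrightarrow> 0 \<le> log_weight \<alpha> \<epsilon> a b"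
  by (simp add: log_weight_def)

text \<open>Tangent bound for a concave function: the weight \<alpha> b / (a b + \<epsilon>) is the
  derivative of \<alpha> ln (a b + \<epsilon>) in a, which is 0 at b = 0 in accordance with the
  convention in \<open>log_weight\<close>. Either the entry of H or the column norm of W can play
  the role of a.\<close>

lemma ln_le_log_weight:
  assumes "0 < \<alpha>" and "0 < \<epsilon>" and "0 \<le> a" and "0 \<le> a'" and "0 \<le> b"
  shows "\<alpha> * ln (a' * b + \<epsilon>) - \<alpha> * ln (a * b + \<epsilon>) \<le> log_weight \<alpha> \<epsilon> a b * (a' - a)"
proof (cases "b = 0")
  case False
  then have b: "0 < b" using assms by simp
  have p: "0 < a * b + \<epsilon>" "0 < a' * b + \<epsilon>" using assms by (auto simp: add_nonneg_pos)
  have "ln (a' * b + \<epsilon>) - ln (a * b + \<epsilon>) \<le> (a' * b + \<epsilon>) / (a * b + \<epsilon>) - 1"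
    using ln_le_minus_one[of "(a' * b + \<epsilon>) / (a * b + \<epsilon>)"] p by (simp add: ln_div)
  also have "\<dots> = (a' - a) / (a + \<epsilon> / b)"
    using p b by (simp add: field_simps)
  finally have "\<alpha> * (ln (a' * b + \<epsilon>) - ln (a * b + \<epsilon>)) \<le> \<alpha> * ((a' - a) / (a + \<epsilon> / b))"
    using assms(1) by (intro mult_left_mono) auto
  then show ?thesis using False by (simp add: log_weight_def flip: right_diff_distrib)
qed (simp add: log_weight_def)

section \<open>The updates of H and W as instances of the descent step\<close>

text \<open>The invariant of the iteration.\<close>

definition admissible :: "real \<Rightarrow> real^'n^'f \<Rightarrow> real^'k^'f \<Rightarrow> real^'n^'k \<Rightarrow> bool" where
  "admissible \<beta> V W H \<longleftrightarrow> mat_nonneg W \<and> mat_nonneg H \<and>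
     (\<forall>f n. beta_div_finite \<beta> (V $ f $ n) ((W ** H) $ f $ n))"

lemma col_l1_nonneg: "0 \<le> col_l1 W k"
  by (simp add: col_l1_def sum_nonneg)

lemma transpose_mult_ones:
  "mat_nonneg W \<Longrightarrow> (transpose W ** (ones :: real^'n^'f)) $ k $ n = col_l1 W k"
  by (simp add: matrix_matrix_mult_def transpose_def ones_def col_l1_def mat_nonneg_def)

lemma update_H_nth:
  assumes "mat_nonneg W"
  shows "update_H \<beta> \<alpha> \<epsilon> V W H $ k $ n = H $ k $ n *
    mm_ratio \<beta> (\<lambda>f k. W $ f $ k) (\<lambda>f. V $ f $ n)
      (\<lambda>k. log_weight \<alpha> \<epsilon> (H $ k $ n) (col_l1 W k)) (\<lambda>k. H $ k $ n) k"
  unfolding update_H_def Let_def mm_ratio_def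
  by (simp add: transpose_mult_ones[OF assms] del: mult_cancel_left)
     (simp add: matrix_matrix_mult_def transpose_def del: mult_cancel_left)

text \<open>Here the fixed factor is the transpose of H, and the slopes are summed over n because a
  column norm of W enters the penalty once for every n. They do not depend on the row f.\<close>

lemma update_W_nth:
  assumes "mat_nonneg W"
  shows "update_W \<beta> \<alpha> \<epsilon> V W H $ f $ k = W $ f $ k *
    mm_ratio \<beta> (\<lambda>n k. H $ k $ n) (\<lambda>n. V $ f $ n)
      (\<lambda>k. \<Sum>n\<in>UNIV. log_weight \<alpha> \<epsilon> (col_l1 W k) (H $ k $ n)) (\<lambda>k. W $ f $ k) k"
  unfolding update_W_def Let_def mm_ratio_def
  by (simp add: transpose_mult_ones[OF assms] del: mult_cancel_left)
     (simp add: matrix_matrix_mult_def transpose_def ones_def mult_ac)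

text \<open>With W fixed, the objective is a sum over the columns of H, so \<open>mm_step\<close>
  applies to each column separately.\<close>

lemma update_H_step:
  assumes adm: "admissible \<beta> V W H" and "0 < \<alpha>" and "0 < \<epsilon>"
  defines "H' \<equiv> update_H \<beta> \<alpha> \<epsilon> V W H"
  shows "admissible \<beta> V W H'" and "J_log \<beta> \<alpha> \<epsilon> V W H' \<le> J_log \<beta> \<alpha> \<epsilon> V W H"
proof -
  have W: "0 \<le> W $ f $ k" and H: "0 \<le> H $ k $ n" for f k n
    using adm by (auto simp: admissible_def mat_nonneg_def)
  have nnW: "mat_nonneg W" using adm by (simp add: admissible_def)
  define l where "l = (\<lambda>n k. log_weight \<alpha> \<epsilon> (H $ k $ n) (col_l1 W k))"
  have l: "0 \<le> l n k" for n k
    using assms(2,3) H by (simp add: l_def log_weight_nonneg col_l1_nonneg)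
  have H': "H' $ k $ n = H $ k $ n *
      mm_ratio \<beta> (\<lambda>f k. W $ f $ k) (\<lambda>f. V $ f $ n) (l n) (\<lambda>k. H $ k $ n) k" for k n
    using update_H_nth[OF nnW] by (simp add: H'_def l_def)
  have H'0: "0 \<le> H' $ k $ n" for k n unfolding H' using H by (rule mult_nonneg_nonneg[OF _ mm_ratio_nonneg])
  have fin: "beta_div_finite \<beta> (V $ f $ n) (\<Sum>k\<in>UNIV. W $ f $ k * H $ k $ n)" for f n
    using adm by (simp add: admissible_def matrix_matrix_mult_def)
  have "beta_div_finite \<beta> (V $ f $ n) (\<Sum>k\<in>UNIV. W $ f $ k * H' $ k $ n)" for f n
    unfolding H' using W H l fin by (rule mm_step_finite)
  then show "admissible \<beta> V W H'"
    using nnW H'0 by (simp add: admissible_def mat_nonneg_def matrix_matrix_mult_def)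
  have div: "(\<Sum>f\<in>UNIV. beta_div \<beta> (V $ f $ n) (\<Sum>k\<in>UNIV. W $ f $ k * H' $ k $ n))
      + (\<Sum>k\<in>UNIV. l n k * (H' $ k $ n - H $ k $ n))
      \<le> (\<Sum>f\<in>UNIV. beta_div \<beta> (V $ f $ n) (\<Sum>k\<in>UNIV. W $ f $ k * H $ k $ n))" for n
    unfolding H' using W H l fin by (rule mm_step_decreasing)
  have log: "\<alpha> * ln (col_l1 W k * H' $ k $ n + \<epsilon>) - \<alpha> * ln (col_l1 W k * H $ k $ n + \<epsilon>)
      \<le> l n k * (H' $ k $ n - H $ k $ n)" for k n
    using ln_le_log_weight[OF assms(2,3) H[of k n] H'0[of k n] col_l1_nonneg[of W k]]
    by (simp add: l_def mult.commute)
  have J: "J_log \<beta> \<alpha> \<epsilon> V W X = (\<Sum>n\<in>UNIV.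
      (\<Sum>f\<in>UNIV. beta_div \<beta> (V $ f $ n) (\<Sum>k\<in>UNIV. W $ f $ k * X $ k $ n))
      + (\<Sum>k\<in>UNIV. \<alpha> * ln (col_l1 W k * X $ k $ n + \<epsilon>)))" for X
    unfolding J_log_def beta_div_mat_def sum.distrib
    by (subst sum.swap, subst (2) sum.swap)
       (simp add: matrix_matrix_mult_def sum_distrib_left)
  show "J_log \<beta> \<alpha> \<epsilon> V W H' \<le> J_log \<beta> \<alpha> \<epsilon> V W H"
    unfolding J
  proof (rule sum_mono)
    fix n
    have "(\<Sum>k\<in>UNIV. \<alpha> * ln (col_l1 W k * H' $ k $ n + \<epsilon>) - \<alpha> * ln (col_l1 W k * H $ k $ n + \<epsilon>))
      \<le> (\<Sum>k\<in>UNIV. l n k * (H' $ k $ n - H $ k $ n))"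
      by (intro sum_mono log)
    then show "(\<Sum>f\<in>UNIV. beta_div \<beta> (V $ f $ n) (\<Sum>k\<in>UNIV. W $ f $ k * H' $ k $ n))
        + (\<Sum>k\<in>UNIV. \<alpha> * ln (col_l1 W k * H' $ k $ n + \<epsilon>))
      \<le> (\<Sum>f\<in>UNIV. beta_div \<beta> (V $ f $ n) (\<Sum>k\<in>UNIV. W $ f $ k * H $ k $ n))
        + (\<Sum>k\<in>UNIV. \<alpha> * ln (col_l1 W k * H $ k $ n + \<epsilon>))"
      using div[of n] by (simp add: sum_subtractf)
  qed
qed

text \<open>The penalty couples the rows of W through the column norms, but its tangent is linear in
  these norms, which for nonnegative W are sums of entries; the linearized objective therefore
  splits into rows.\<close>

lemma update_W_step:
  assumes adm: "admissible \<beta> V W H" and "0 < \<alpha>" and "0 < \<epsilon>"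
  defines "W' \<equiv> update_W \<beta> \<alpha> \<epsilon> V W H"
  shows "admissible \<beta> V W' H" and "J_log \<beta> \<alpha> \<epsilon> V W' H \<le> J_log \<beta> \<alpha> \<epsilon> V W H"
proof -
  have W: "0 \<le> W $ f $ k" and H: "0 \<le> H $ k $ n" for f k n
    using adm by (auto simp: admissible_def mat_nonneg_def)
  have nnW: "mat_nonneg W" using adm by (simp add: admissible_def)
  define l where "l = (\<lambda>k. \<Sum>n\<in>UNIV. log_weight \<alpha> \<epsilon> (col_l1 W k) (H $ k $ n))"
  have l: "0 \<le> l k" for k
    using assms(2,3) H by (simp add: l_def log_weight_nonneg col_l1_nonneg sum_nonneg)
  have W': "W' $ f $ k = W $ f $ k *
      mm_ratio \<beta> (\<lambda>n k. H $ k $ n) (\<lambda>n. V $ f $ n) l (\<lambda>k. W $ f $ k) k" for f k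
    using update_W_nth[OF nnW] by (simp add: W'_def l_def)
  have W'0: "0 \<le> W' $ f $ k" for f k unfolding W' using W by (rule mult_nonneg_nonneg[OF _ mm_ratio_nonneg])
  have fin: "beta_div_finite \<beta> (V $ f $ n) (\<Sum>k\<in>UNIV. H $ k $ n * W $ f $ k)" for f n
    using adm by (simp add: admissible_def matrix_matrix_mult_def mult.commute)
  have "beta_div_finite \<beta> (V $ f $ n) (\<Sum>k\<in>UNIV. H $ k $ n * W' $ f $ k)" for f n
    unfolding W' using H W l fin by (rule mm_step_finite)
  then show "admissible \<beta> V W' H"
    using adm W'0 by (simp add: admissible_def mat_nonneg_def matrix_matrix_mult_def mult.commute)
  have div: "(\<Sum>n\<in>UNIV. beta_div \<beta> (V $ f $ n) (\<Sum>k\<in>UNIV. H $ k $ n * W' $ f $ k))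
      + (\<Sum>k\<in>UNIV. l k * (W' $ f $ k - W $ f $ k))
      \<le> (\<Sum>n\<in>UNIV. beta_div \<beta> (V $ f $ n) (\<Sum>k\<in>UNIV. H $ k $ n * W $ f $ k))" for f
    unfolding W' using H W l fin by (rule mm_step_decreasing)
  have div': "beta_div_mat \<beta> V (W' ** H) + (\<Sum>f\<in>UNIV. \<Sum>k\<in>UNIV. l k * (W' $ f $ k - W $ f $ k))
      \<le> beta_div_mat \<beta> V (W ** H)"
    using sum_mono[OF div, where K=UNIV]
    by (simp add: beta_div_mat_def matrix_matrix_mult_def mult.commute sum.distrib)
  \<comment> \<open>Nonnegativity of both matrices removes the absolute values in the column
    norms.\<close>
  have "(\<Sum>f\<in>UNIV. \<Sum>k\<in>UNIV. l k * (W' $ f $ k - W $ f $ k)) = (\<Sum>k\<in>UNIV. l k * (col_l1 W' k - col_l1 W k))"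
    using W W'0 by (subst sum.swap) (simp add: col_l1_def sum_distrib_left sum_subtractf algebra_simps)
  also have "\<dots> = (\<Sum>k\<in>UNIV. \<Sum>n\<in>UNIV. log_weight \<alpha> \<epsilon> (col_l1 W k) (H $ k $ n) * (col_l1 W' k - col_l1 W k))"
    by (simp add: l_def sum_distrib_right)
  also have "\<dots> \<ge> (\<Sum>k\<in>UNIV. \<Sum>n\<in>UNIV.
      \<alpha> * ln (col_l1 W' k * H $ k $ n + \<epsilon>) - \<alpha> * ln (col_l1 W k * H $ k $ n + \<epsilon>))"
    using assms(2,3) H by (intro sum_mono ln_le_log_weight) (auto simp: col_l1_nonneg)
  finally show "J_log \<beta> \<alpha> \<epsilon> V W' H \<le> J_log \<beta> \<alpha> \<epsilon> V W H"
    using div' by (simp add: J_log_def sum_subtractf sum_distrib_left)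
qed

section \<open>Boundedness from below and convergence\<close>

text \<open>The divergence is nonnegative and each logarithm has an argument of at least \<epsilon>;
  the bound is the same for all iterates.\<close>

lemma J_log_lower_bound:
  fixes V :: "real^'n^'f" and W :: "real^'k^'f"
  assumes "admissible \<beta> V W H" and "0 < \<alpha>" and "0 < \<epsilon>"
  shows "\<alpha> * (\<Sum>k\<in>(UNIV :: 'k set). \<Sum>n\<in>(UNIV :: 'n set). ln \<epsilon>) \<le> J_log \<beta> \<alpha> \<epsilon> V W H"
proof -
  have "0 \<le> beta_div_mat \<beta> V (W ** H)"
    using assms(1) by (auto simp: beta_div_mat_def admissible_def intro!: sum_nonneg beta_div_nonneg)
  moreover have "ln \<epsilon> \<le> ln (col_l1 W k * H $ k $ n + \<epsilon>)" for k n
    using assms by (auto simp: admissible_def mat_nonneg_def col_l1_nonneg add_nonneg_pos)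
  then have "(\<Sum>k\<in>(UNIV :: 'k set). \<Sum>n\<in>(UNIV :: 'n set). ln \<epsilon>)
      \<le> (\<Sum>k\<in>UNIV. \<Sum>n\<in>UNIV. ln (col_l1 W k * H $ k $ n + \<epsilon>))"
    by (intro sum_mono)
  ultimately show ?thesis
    unfolding J_log_def using assms(2) by (smt (verit) mult_left_mono)
qed

theorem mainTheorem3:
  fixes V :: "real^'n^'f" and W_init :: "real^'k^'f" and H_init :: "real^'n^'k"
    and \<beta> \<alpha> \<epsilon> :: real and W :: "nat \<Rightarrow> real^'k^'f" and H :: "nat \<Rightarrow> real^'n^'k"
  assumes "mat_nonneg V" and "mat_nonneg W_init" and "mat_nonneg H_init"
    and "0 < \<alpha>" and "0 < \<epsilon>"
    and "\<forall>f n. beta_div_finite \<beta> (V $ f $ n) ((W_init ** H_init) $ f $ n)"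
    and "\<forall>i. (W i, H i) = mm_snmf_log \<beta> \<alpha> \<epsilon> V W_init H_init i"
  shows "decseq (\<lambda>i. J_log \<beta> \<alpha> \<epsilon> V (W i) (H i)) \<and>
         convergent (\<lambda>i. J_log \<beta> \<alpha> \<epsilon> V (W i) (H i))"
proof -
  let ?J = "\<lambda>i. J_log \<beta> \<alpha> \<epsilon> V (W i) (H i)"
  have start: "W 0 = W_init" "H 0 = H_init"
    using assms(7)[rule_format, of 0] by simp_all
  have H_Suc: "H (Suc i) = update_H \<beta> \<alpha> \<epsilon> V (W i) (H i)"
    and W_Suc: "W (Suc i) = update_W \<beta> \<alpha> \<epsilon> V (W i) (H (Suc i))" for i
    using assms(7)[rule_format, of "Suc i"] assms(7)[rule_format, of i, symmetric]
    by (simp_all add: Let_def)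
  have adm: "admissible \<beta> V (W i) (H i)" for i
  proof (induction i)
    case 0
    show ?case using assms(2,3,6) by (simp add: start admissible_def)
  next
    case (Suc i)
    then show ?case
      unfolding W_Suc unfolding H_Suc
      by (intro update_W_step(1) update_H_step(1) assms(4,5))
  qed
  have "?J (Suc i) \<le> ?J i" for i
  proof -
    \<comment> \<open>The chain passes through the half step with the new H and the old W, which is
      admissible by the first claim of \<open>update_H_step\<close>.\<close>
    have "?J (Suc i) \<le> J_log \<beta> \<alpha> \<epsilon> V (W i) (H (Suc i))"
      unfolding W_Suc unfolding H_Suc
      by (intro update_W_step(2) update_H_step(1) adm assms(4,5))
    also have "\<dots> \<le> ?J i"
      unfolding H_Suc by (intro update_H_step(2) adm assms(4,5))
    finally show ?thesis .
  qed
  then have dec: "decseq ?J" by (intro decseq_SucI)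
  moreover have "convergent ?J"
    using decseq_convergent[OF dec allI[OF J_log_lower_bound[OF adm assms(4,5)]]]
    by (metis convergentI)
  ultimately show ?thesis by blast
qed

end
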